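(* Under the standing assumptions A1--A4 (see context), let $\bar u\in\operatorname{dom}g$, $X\in\{Y,\mathcal U^*\}$, and constants $R,\lambda,\eta,\theta>0$ be given such that for all $u\in B_R(\bar u)$ with $J(u)\le J(\bar u)+\eta$ both the Polyak--Łojasiewicz--Kurdyka inequality $$J(u)-J(\bar u)\le\frac\lambda2\inf\{\|\nabla f(u)+\xi\|_X^2\mid\xi\in\partial g(u)\cap X\}$$ and the quadratic growth inequality $$\frac\theta2\|u-\bar u\|_{\mathcal U}^2\le J(u)-J(\bar u)$$ hold. Then strong metric subregularity holds at $\bar u$ with constants $R$ and $\nu=\sqrt{\theta/\lambda}$ (and the same $X$, $\eta$), i.e. $$\|u-\bar u\|_{\mathcal U}\le\frac1\nu\inf\{\|\nabla f(u)+\xi\|_X\mid\xi\in\partial g(u)\cap X\}\qquad\forall u\in B_R(\bar u)\text{ with }J(u)\le J(\bar u)+\eta.$$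
   Context: Standing assumptions. (A1) $\mathcal U\cong Y^*$, where $Y$ is a separable Banach space with norm $\|\cdot\|_Y$; $\langle\cdot,\cdot\rangle$ is the pairing between $Y$ and $\mathcal U$, and $\mathcal U$ carries the dual norm $\|u\|_{\mathcal U}=\sup_{\|y\|_Y\le1}\langle y,u\rangle$. (A2) $g:\mathcal U\to[0,\infty]$ is proper, convex and sequentially weak* lower semicontinuous. (A3) $f:\mathcal U\to[0,\infty)$ is sequentially weak* lower semicontinuous on $\operatorname{dom}g$, and there are a neighborhood $\mathcal N$ of $\operatorname{dom}g$ in $\mathcal U$ and a map $\nabla f:\operatorname{dom}g\to Y$ such that $f$ is Gâteaux differentiable on $\mathcal N$ with $f'(u)(\delta u)=\langle\nabla f(u),\delta u\rangle$ for all $u\in\operatorname{dom}g$, $\delta u\in\mathcal U$; moreover there is $L_{\nabla f}\ge0$ with $\|\nabla f(u_1)-\nabla f(u_2)\|_Y\le L_{\nabla f}\|u_1-u_2\|_{\mathcal U}$ for all $u_1,u_2\in\operatorname{dom}g$. (A4) With $J:=f+g$: if $\|u_k\|_{\mathcal U}\to\infty$ then $J(u_k)\to\infty$. $\mathcal U^*$ is the dual of $\mathcal U$ with its canonical norm; $Y$ is regarded as a subspace of $\mathcal U^*=Y^{**}$ via the canonical isometric embedding; $\partial g(u)\subset\mathcal U^*$ is the convex subdifferential. $B_R(\bar u)$ is the closed ball of radius $R$ around $\bar u$ in $\mathcal U$. The infimum over the empty set is $+\infty$. *)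

theory Defs
  imports "HOL-Analysis.Analysis"
begin

text \<open>
  \<open>'u\<close> is identified with the dual of \<open>'y\<close> through a map \<open>\<Phi>\<close>; the pairing of
  \<open>y\<close> and \<open>u\<close> is \<open>\<Phi> u y\<close>.  The supremum is over a nonempty set that is bounded above,
  since each \<open>\<Phi> u\<close> is a bounded functional.
\<close>

definition dual_iso ::
    "('u::real_normed_vector \<Rightarrow> 'y::real_normed_vector \<Rightarrow>\<^sub>L real) \<Rightarrow> bool" where
  "dual_iso \<Phi> \<longleftrightarrow> linear \<Phi> \<and> bij \<Phi> \<and>
     (\<forall>u. norm u = (SUP y\<in>{y. norm y \<le> 1}. blinfun_apply (\<Phi> u) y))"

text \<open>
  The embedding is isometric (Hahn--Banach), so as a subspace of the dual of \<open>'u\<close> its range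
  carries the norm of \<open>'y\<close>.  The functional passed to \<^term>\<open>Blinfun\<close> is bounded linear
  whenever \<open>dual_iso \<Phi>\<close> holds.
\<close>

definition canonical_embedding ::
    "('u::real_normed_vector \<Rightarrow> 'y::real_normed_vector \<Rightarrow>\<^sub>L real) \<Rightarrow> 'y \<Rightarrow> 'u \<Rightarrow>\<^sub>L real" where
  "canonical_embedding \<Phi> y = Blinfun (\<lambda>u. blinfun_apply (\<Phi> u) y)"

lemma canonical_embedding_apply:
  assumes "dual_iso \<Phi>"
  shows "blinfun_apply (canonical_embedding \<Phi> y) u = blinfun_apply (\<Phi> u) y"
proof -
  have lin: "linear \<Phi>"
    and nrm: "\<And>u. norm u = (SUP y\<in>{y. norm y \<le> 1}. blinfun_apply (\<Phi> u) y)"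
    using assms by (auto simp: dual_iso_def)
  have unit: "blinfun_apply (\<Phi> u) z \<le> norm u" if "norm z \<le> 1" for u z
  proof -
    have "bdd_above (blinfun_apply (\<Phi> u) ` {y. norm y \<le> 1})"
    proof (rule bdd_aboveI2)
      fix x :: 'b assume "x \<in> {y. norm y \<le> 1}"
      then have "norm (\<Phi> u) * norm x \<le> norm (\<Phi> u)"
        by (simp add: mult_left_le)
      then show "blinfun_apply (\<Phi> u) x \<le> norm (\<Phi> u)"
        using norm_blinfun[of "\<Phi> u" x] by simp
    qed
    then show ?thesis
      using that by (subst nrm) (rule cSUP_upper, auto)
  qed
  have scaled: "blinfun_apply (\<Phi> u) z \<le> norm u * norm z" for u z
  proof (cases "z = 0")
    case False
    then show ?thesis
      using unit[of "z /\<^sub>R norm z" u]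
      by (simp add: blinfun.scaleR_right field_simps)
  qed simp
  have bnd: "norm (blinfun_apply (\<Phi> u) y) \<le> norm u * norm y" for u
    using scaled[of u y] scaled[of u "- y"] by (simp add: blinfun.minus_right abs_le_iff)
  have "bounded_linear (\<lambda>u. blinfun_apply (\<Phi> u) y)"
    using bnd
    by (intro bounded_linear_intro[where K = "norm y"])
       (simp_all add: linear_add[OF lin] linear_scale[OF lin] blinfun.add_left blinfun.scaleR_left)
  then show ?thesis
    by (simp add: canonical_embedding_def bounded_linear_Blinfun_apply)
qed

definition weakstar_tendsto ::
    "('u \<Rightarrow> 'y::real_normed_vector \<Rightarrow>\<^sub>L real) \<Rightarrow> (nat \<Rightarrow> 'u) \<Rightarrow> 'u \<Rightarrow> bool" where
  "weakstar_tendsto \<Phi> s u \<longleftrightarrow>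
     (\<forall>y. (\<lambda>k. blinfun_apply (\<Phi> (s k)) y) \<longlonglongrightarrow> blinfun_apply (\<Phi> u) y)"

definition seq_weakstar_lsc_on ::
    "('u \<Rightarrow> 'y::real_normed_vector \<Rightarrow>\<^sub>L real) \<Rightarrow> 'u set \<Rightarrow> ('u \<Rightarrow> ereal) \<Rightarrow> bool" where
  "seq_weakstar_lsc_on \<Phi> S F \<longleftrightarrow>
     (\<forall>s u. (\<forall>k. s k \<in> S) \<longrightarrow> u \<in> S \<longrightarrow> weakstar_tendsto \<Phi> s u \<longrightarrow>
        F u \<le> liminf (\<lambda>k. F (s k)))"

definition effective_domain :: "('u \<Rightarrow> ereal) \<Rightarrow> 'u set" where
  "effective_domain g = {u. g u < \<infinity>}"

definition proper_fun :: "('u \<Rightarrow> ereal) \<Rightarrow> bool" where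
  "proper_fun g \<longleftrightarrow> (\<forall>u. g u \<noteq> -\<infinity>) \<and> effective_domain g \<noteq> {}"

text \<open>For \<open>t = 0\<close> or \<open>t = 1\<close> this uses \<open>0 * \<infinity> = 0\<close> in \<^typ>\<open>ereal\<close>.\<close>

definition convex_fun :: "('u::real_vector \<Rightarrow> ereal) \<Rightarrow> bool" where
  "convex_fun g \<longleftrightarrow>
     (\<forall>u v. \<forall>t\<in>{0..1}.
        g ((1 - t) *\<^sub>R u + t *\<^sub>R v) \<le> ereal (1 - t) * g u + ereal t * g v)"

definition has_gateaux_derivative ::
    "('u::real_normed_vector \<Rightarrow> real) \<Rightarrow> ('u \<Rightarrow>\<^sub>L real) \<Rightarrow> 'u \<Rightarrow> bool" where
  "has_gateaux_derivative f D u \<longleftrightarrow>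
     (\<forall>h. ((\<lambda>t::real. (f (u + t *\<^sub>R h) - f u) / t) \<longlongrightarrow> blinfun_apply D h) (at 0))"

definition subdifferential ::
    "('u::real_normed_vector \<Rightarrow> ereal) \<Rightarrow> 'u \<Rightarrow> ('u \<Rightarrow>\<^sub>L real) set" where
  "subdifferential g u =
     {\<xi>. u \<in> effective_domain g \<and> (\<forall>v. g u + ereal (blinfun_apply \<xi> (v - u)) \<le> g v)}"

end

theory Submission
  imports Defs
begin

text \<open>
  Both hypotheses bound the same energy gap \<open>J u - J ubar\<close>, growth from below by
  \<open>\<theta>/2 \<parallel>u - ubar\<parallel>\<^sup>2\<close> and the Polyak--Lojasiewicz--Kurdyka inequality from above by
  \<open>lam/2\<close> times an infimum of squared norms.  Chaining them eliminates the gap: every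
  \<open>\<xi>\<close> in the index set satisfies
  \<open>\<theta> \<parallel>u - ubar\<parallel>\<^sup>2 \<le> lam \<parallel>\<nabla>f(u) + \<xi>\<parallel>\<^sup>2\<close>, and a square root followed by the
  infimum over \<open>\<xi>\<close> gives the claim.  What remains is a statement about real numbers,
  isolated in \<open>le_INF_of_squared_le_INF\<close>.
\<close>

text \<open>
  The square root is taken at each index separately, so that it never has to be exchanged with
  the infimum, which is \<open>\<infinity>\<close> when \<open>S\<close> is empty.
\<close>

lemma le_INF_of_squared_le_INF:
  fixes n :: "'a \<Rightarrow> real" and d a b :: real
  assumes "a > 0" "b > 0" and n: "\<And>x. x \<in> S \<Longrightarrow> 0 \<le> n x"
    and sq: "ereal (a / 2 * d\<^sup>2) \<le> ereal (b / 2) * (INF x\<in>S. ereal ((n x)\<^sup>2))"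
  shows "ereal d \<le> ereal (1 / sqrt (a / b)) * (INF x\<in>S. ereal (n x))"
proof -
  let ?\<nu> = "sqrt (a / b)"
  have \<nu>: "?\<nu> > 0"
    using assms(1,2) by simp
  have "ereal (?\<nu> * d) \<le> (INF x\<in>S. ereal (n x))"
  proof (rule INF_greatest)
    fix x assume x: "x \<in> S"
    note sq
    also have "ereal (b / 2) * (INF x\<in>S. ereal ((n x)\<^sup>2)) \<le> ereal (b / 2) * ereal ((n x)\<^sup>2)"
      using x assms(2) by (intro ereal_mult_left_mono INF_lower) auto
    finally have "a * d\<^sup>2 \<le> b * (n x)\<^sup>2"
      by simp
    then have "(?\<nu> * d)\<^sup>2 \<le> (n x)\<^sup>2"
      using assms(1,2) by (simp add: power_mult_distrib field_simps)
    then have "?\<nu> * d \<le> n x"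
      using n[OF x] by (rule power2_le_imp_le)
    then show "ereal (?\<nu> * d) \<le> ereal (n x)"
      by simp
  qed
  then have "ereal (1 / ?\<nu>) * ereal (?\<nu> * d) \<le> ereal (1 / ?\<nu>) * (INF x\<in>S. ereal (n x))"
    using \<nu> by (intro ereal_mult_left_mono) auto
  moreover have "ereal (1 / ?\<nu>) * ereal (?\<nu> * d) = ereal d"
    using assms(1,2) by simp
  ultimately show ?thesis
    by simp
qed

theorem lemma6p5:
  fixes \<Phi> :: "'u::real_normed_vector \<Rightarrow> 'y::banach \<Rightarrow>\<^sub>L real"
    and f :: "'u \<Rightarrow> real"
    and g J :: "'u \<Rightarrow> ereal"
    and gradf :: "'u \<Rightarrow> 'y"
    and X :: "('u \<Rightarrow>\<^sub>L real) set"
    and ubar :: 'u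
    and R lam \<eta> \<theta> :: real
  assumes J: "J = (\<lambda>u. ereal (f u) + g u)"
    and A1: "separable_space (euclidean :: 'y topology)" "dual_iso \<Phi>"
    and A2: "\<forall>u. 0 \<le> g u" "proper_fun g" "convex_fun g" "seq_weakstar_lsc_on \<Phi> UNIV g"
    and A3: "\<forall>u. 0 \<le> f u"
      "seq_weakstar_lsc_on \<Phi> (effective_domain g) (\<lambda>u. ereal (f u))"
      "\<exists>N f'. effective_domain g \<subseteq> interior N \<and>
         (\<forall>u\<in>N. has_gateaux_derivative f (f' u) u) \<and>
         (\<forall>u\<in>effective_domain g. \<forall>\<delta>u.
            blinfun_apply (f' u) \<delta>u = blinfun_apply (\<Phi> \<delta>u) (gradf u))"
      "\<exists>L\<ge>0. \<forall>u1\<in>effective_domain g. \<forall>u2\<in>effective_domain g.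
         norm (gradf u1 - gradf u2) \<le> L * norm (u1 - u2)"
    and A4: "\<forall>s :: nat \<Rightarrow> 'u. filterlim (\<lambda>k. norm (s k)) at_top sequentially \<longrightarrow>
         (\<lambda>k. J (s k)) \<longlonglongrightarrow> \<infinity>"
    and ubar: "ubar \<in> effective_domain g"
    and X: "X \<in> {range (canonical_embedding \<Phi>), UNIV}"
    and pos: "R > 0" "lam > 0" "\<eta> > 0" "\<theta> > 0"
    and PLK: "\<forall>u\<in>cball ubar R. J u \<le> J ubar + ereal \<eta> \<longrightarrow>
         J u - J ubar \<le> ereal (lam / 2) *
           (INF \<xi>\<in>subdifferential g u \<inter> X.
              ereal ((norm (canonical_embedding \<Phi> (gradf u) + \<xi>))\<^sup>2))"
    and growth: "\<forall>u\<in>cball ubar R. J u \<le> J ubar + ereal \<eta> \<longrightarrow>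
         ereal (\<theta> / 2 * (norm (u - ubar))\<^sup>2) \<le> J u - J ubar"
  shows "\<forall>u\<in>cball ubar R. J u \<le> J ubar + ereal \<eta> \<longrightarrow>
         ereal (norm (u - ubar)) \<le> ereal (1 / sqrt (\<theta> / lam)) *
           (INF \<xi>\<in>subdifferential g u \<inter> X.
              ereal (norm (canonical_embedding \<Phi> (gradf u) + \<xi>)))"
proof (intro ballI impI)
  fix u assume u: "u \<in> cball ubar R" "J u \<le> J ubar + ereal \<eta>"
  have "ereal (\<theta> / 2 * (norm (u - ubar))\<^sup>2) \<le> J u - J ubar"
    using growth u by blast
  also have "J u - J ubar \<le> ereal (lam / 2) *
      (INF \<xi>\<in>subdifferential g u \<inter> X.
         ereal ((norm (canonical_embedding \<Phi> (gradf u) + \<xi>))\<^sup>2))"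
    using PLK u by blast
  finally show "ereal (norm (u - ubar)) \<le> ereal (1 / sqrt (\<theta> / lam)) *
      (INF \<xi>\<in>subdifferential g u \<inter> X.
         ereal (norm (canonical_embedding \<Phi> (gradf u) + \<xi>)))"
    using pos by (intro le_INF_of_squared_le_INF) auto
qed

end
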